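(* Let $\alpha > 0$. Suppose that there exist $c < r/d$ and $\eta > 0$ such that, for every $X \ge 1$ and every $N$ with $0 < N < X^{\alpha}$, setting $Z := 2 N X^{\eta - 1/d}$, we have $$X^{r/d} \sum_{q \in [N, 2N]} \ \sum_{\substack{0 \neq x \in V^\ast(\mathbb{Z}) \\ |x_i| \leq Z \ \forall i}} |\widehat{\Psi_q}(x)| \ll X^c,$$ with implied constant independent of $N$ and $X$. Then, for the same $\alpha$, there exists $c' < r/d$ such that $$\sum_{q < X^{\alpha}} |E(X, \Psi_q, \phi)| \ll X^{c'}$$ for all $X \ge 1$, with implied constant independent of $X$.
   Context: $V(\mathbb{Z})$ is a complete lattice in a real vector space $V(\mathbb{R})$ of dimension $r$, identified with $\mathbb{Z}^r\subset\mathbb{R}^r$ by a choice of basis; $V^\ast(\mathbb{Z}) \subset V^\ast(\mathbb{R})$ is the dual lattice in the dual space, with coordinates $x_1,\dots,x_r$ in the dual basis, and $[\cdot,\cdot]$ is the duality pairing. $d$ is any fixed positive real constant. All sums over $q$ are over squarefree positive integers only. For each squarefree $q$, $\Psi_q : V(\mathbb{Z}) \to \mathbb{C}$ is a function which factors through the reduction map $V(\mathbb{Z}) \to V(\mathbb{Z}/q\mathbb{Z})$ and satisfies $|\Psi_q(x)| \le 1$ for all $x$. Its Fourier transform is $$\widehat{\Psi_q}(x) = q^{-r} \sum_{x' \in V(\mathbb{Z}/q\mathbb{Z})} \Psi_q(x') \exp\left(\frac{2\pi i [x',x]}{q}\right),\qquad x \in V^\ast(\mathbb{Z}/q\mathbb{Z}),$$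 regarded also as a function on $V^\ast(\mathbb{Z})$ via reduction mod $q$. $\phi$ is a fixed smooth Schwartz class function on $V(\mathbb{R})$, with Fourier transform $\widehat{\phi}(y)=\int_{V(\mathbb{R})}\phi(v)\exp(-2\pi i[v,y])\,dv$, where $V(\mathbb{Z})$ has covolume $1$. The error term is $$E(X, \Psi_q, \phi) := X^{r/d} \sum_{0 \neq x \in V^\ast(\mathbb{Z})} \widehat{\Psi_q}(x)\, \widehat{\phi}\left(\frac{x X^{1/d}}{q}\right),$$ so that, by Poisson summation, $\sum_{x \in V(\mathbb{Z})} \Psi_q(x)\phi(xX^{-1/d}) = \widehat{\Psi_q}(0)\widehat{\phi}(0)X^{r/d} + E(X,\Psi_q,\phi)$. Implied constants may depend on $\phi$, $V$, $d$, the functions $\Psi_q$, and on $\alpha, c, c', \eta$. *)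

theory Defs
  imports
    "HOL-Analysis.Analysis"
    "HOL-Number_Theory.Cong"
    "HOL-Computational_Algebra.Squarefree"
begin

(* The lattice V(Z) and its dual V*(Z) are both represented by int ^ 'n (coordinates with respect
   to a basis of V(Z), respectively the dual basis of V*(Z)), V(R) and V*(R) by real ^ 'n, and
   r by CARD('n).  The duality pairing is then scalar_product on the lattices and the inner
   product on the real spaces, and lborel is the Haar measure for which V(Z) has covolume 1. *)

definition real_vec :: "int ^ 'n \<Rightarrow> real ^ 'n" where
  "real_vec x = (\<chi> i. real_of_int (x $ i))"

definition factors_mod :: "nat \<Rightarrow> (int ^ 'n \<Rightarrow> 'b) \<Rightarrow> bool" where
  "factors_mod q f \<longleftrightarrow> (\<forall>x y. (\<forall>i. [x $ i = y $ i] (mod int q)) \<longrightarrow> f x = f y)"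

(* The standard system of representatives of V(Z/qZ), for q > 0. *)
definition residue_vecs :: "nat \<Rightarrow> (int ^ 'n) set" where
  "residue_vecs q = {x. \<forall>i. 0 \<le> x $ i \<and> x $ i < int q}"

(* The Fourier transform on V(Z/qZ), lifted to V*(Z).  For f with factors_mod q f the sum does not
   depend on the choice of representatives, and the result is again q-periodic. *)
definition fourier_mod ::
    "nat \<Rightarrow> (int ^ 'n::finite \<Rightarrow> complex) \<Rightarrow> int ^ 'n \<Rightarrow> complex" where
  "fourier_mod q f x =
     (\<Sum>x' \<in> residue_vecs q.
        f x' * exp (2 * of_real pi * \<i> * of_int (scalar_product x' x) / of_nat q))
     / of_nat q ^ CARD('n)"

definition partial_deriv ::
    "'n \<Rightarrow> (real ^ 'n::finite \<Rightarrow> complex) \<Rightarrow> real ^ 'n \<Rightarrow> complex" where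
  "partial_deriv i f x = vector_derivative (\<lambda>t. f (x + t *\<^sub>R axis i 1)) (at 0)"

definition iter_partial_deriv ::
    "'n list \<Rightarrow> (real ^ 'n::finite \<Rightarrow> complex) \<Rightarrow> real ^ 'n \<Rightarrow> complex" where
  "iter_partial_deriv js f = foldr partial_deriv js f"

(* The first conjunct says that f is C-infinity: if all iterated partial derivatives exist and are
   (Frechet) differentiable everywhere, then all of them are continuous. *)
definition schwartz :: "(real ^ 'n::finite \<Rightarrow> complex) \<Rightarrow> bool" where
  "schwartz f \<longleftrightarrow>
     (\<forall>js x. iter_partial_deriv js f differentiable (at x)) \<and>
     (\<forall>js (k::nat). \<exists>C. \<forall>x. norm x ^ k * norm (iter_partial_deriv js f x) \<le> C)"

definition fourier_real :: "(real ^ 'n::finite \<Rightarrow> complex) \<Rightarrow> real ^ 'n \<Rightarrow> complex" where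
  "fourier_real f y =
     (\<integral>v. f v * exp (- 2 * of_real pi * \<i> * of_real (v \<bullet> y)) \<partial>lborel)"

(* The sum over the nonzero dual lattice vectors is absolutely convergent when \<phi> is Schwartz and
   X, q > 0. *)
definition error_term ::
    "real \<Rightarrow> real \<Rightarrow> nat \<Rightarrow> (int ^ 'n::finite \<Rightarrow> complex) \<Rightarrow> (real ^ 'n \<Rightarrow> complex) \<Rightarrow> complex" where
  "error_term d X q f \<phi> =
     of_real (X powr (real CARD('n) / d)) *
     (\<Sum>\<^sub>\<infinity>x \<in> {x :: int ^ 'n. x \<noteq> 0}.
        fourier_mod q f x * fourier_real \<phi> ((X powr (1 / d) / real q) *\<^sub>R real_vec x))"

end

theory Submission
  imports Defs "HOL-Probability.Sinc_Integral"
begin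

text \<open>
  The error term is a sum over nonzero dual lattice vectors of a coefficient of modulus at most 1
  times a Fourier transform evaluated at \<open>x X\<^bsup>1/d\<^esup> / q\<close>.  For \<open>q\<close> in a dyadic block \<open>[N, 2N]\<close> the
  box \<open>\<bar>x\<^sub>i\<bar> \<le> Z = 2 N X\<^bsup>\<eta> - 1/d\<^esup>\<close> is chosen so that outside it some coordinate of that argument has
  size at least \<open>X\<^bsup>\<eta>\<^esup>\<close>.  The Fourier transform of a Schwartz function decays faster than any power,
  so the part of the sum outside the box is smaller than any prescribed negative power of \<open>X\<close>, and
  since \<open>q\<close> is bounded by a fixed power of \<open>X\<close>, summing it over all \<open>q\<close> costs only another fixed
  power (\<open>error_term_bound\<close>).  Inside the box the Fourier transform is bounded, and what remains is
  exactly the quantity controlled by the hypothesis.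

  The range \<open>q < X\<^bsup>\<alpha>\<^esup>\<close> is covered by \<open>O(log X)\<close> dyadic blocks (\<open>dyadic_sum_bound\<close>).  The logarithm is
  at most a small power of \<open>X\<close>, which is absorbed by moving from \<open>c\<close> to some \<open>c'\<close> strictly between
  \<open>c\<close> and \<open>r/d\<close>.

  The decay of the Fourier transform (\<open>fourier_real_decay\<close>) comes from the identity
  \<open>(\<partial>\<^sub>i f)^(y) = 2 \<pi> \<i> y\<^sub>i f^(y)\<close>.  Instead of integrating by parts in one coordinate, which would
  require splitting the space as a product, one differentiates under the integral sign the
  translation law \<open>(f(\<cdot> + a))^(y) = exp(2 \<pi> \<i> a \<bullet> y) f^(y)\<close>.
  Convergence of the sum outside the box is obtained by comparing a high power of the sup norm with
  the weight \<open>\<Prod>\<^sub>j 2 / (1 + x\<^sub>j\<^sup>2)\<close>, whose sum over the lattice factors into one-dimensional sums.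
\<close>

section \<open>Decay of the Fourier transform of a Schwartz function\<close>

definition rapidly_decreasing :: "('a::real_normed_vector \<Rightarrow> 'b::real_normed_vector) \<Rightarrow> bool" where
  "rapidly_decreasing f \<longleftrightarrow> (\<forall>k::nat. \<exists>C. \<forall>x. (1 + norm x) ^ k * norm (f x) \<le> C)"

text \<open>
  Up to constants, this function dominates every integrand below.  Its product form lets integrability be read
  off from the one-dimensional arctangent integral.
\<close>
lemma integrable_prod_inverse_1_plus_square:
  "integrable lborel (\<lambda>v::'a::euclidean_space. \<Prod>b\<in>Basis. inverse (1 + (v \<bullet> b)\<^sup>2))"
proof -
  have int1: "integrable lborel (\<lambda>x::real. inverse (1 + x\<^sup>2))"
    using integrable_inverse_1_plus_square by (simp add: set_integrable_def)
  have fin1: "(\<integral>\<^sup>+x. ennreal (inverse (1 + x\<^sup>2)) \<partial>lborel) < \<infinity>"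
    using int1 by (simp add: integrable_iff_bounded)
  have "(\<integral>\<^sup>+v. ennreal (norm (\<Prod>b\<in>Basis. inverse (1 + (v \<bullet> b)\<^sup>2))) \<partial>(lborel :: 'a measure))
      = (\<integral>\<^sup>+v. (\<Prod>b\<in>Basis. ennreal (inverse (1 + (v \<bullet> b)\<^sup>2))) \<partial>(lborel :: 'a measure))"
    by (intro nn_integral_cong) (simp add: prod_ennreal prod_nonneg abs_prod)
  also have "\<dots> = (\<Prod>b\<in>(Basis::'a set). \<integral>\<^sup>+x. ennreal (inverse (1 + x\<^sup>2)) \<partial>lborel)"
    by (rule nn_integral_lborel_prod) auto
  also have "\<dots> < \<infinity>"
    using fin1 by (simp add: power_less_top_ennreal)
  finally show ?thesis
    by (intro integrableI_bounded) auto
qed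

text \<open>
  Difference quotients of \<open>f\<close> at \<open>v\<close> with step at most 1 involve derivatives at points \<open>v + u\<close> with
  \<open>norm u \<le> 1\<close>.  Dominated convergence needs one bound for all these \<open>u\<close>, and a shift by at
  most 1 changes \<open>1 + norm v\<close> by at most a factor 2.
\<close>
lemma rapidly_decreasing_bound:
  fixes f :: "'a::euclidean_space \<Rightarrow> 'b::real_normed_vector"
  assumes "rapidly_decreasing f"
  shows "\<exists>C\<ge>0. \<forall>v u. norm u \<le> 1 \<longrightarrow>
           norm (f (v + u)) \<le> C * (\<Prod>b\<in>Basis. inverse (1 + (v \<bullet> b)\<^sup>2))"
proof -
  define m where "m = 2 * DIM('a)"
  obtain C where C: "\<And>x. (1 + norm x) ^ m * norm (f x) \<le> C"
    using assms unfolding rapidly_decreasing_def by blast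
  have C0: "C \<ge> 0"
    using order_trans[OF _ C[of 0]] by simp
  have "norm (f (v + u)) \<le> (C * 2 ^ m) * (\<Prod>b\<in>Basis. inverse (1 + (v \<bullet> b)\<^sup>2))"
    if "norm u \<le> 1" for v u :: 'a
  proof -
    let ?P = "\<Prod>b\<in>(Basis::'a set). 1 + (v \<bullet> b)\<^sup>2"
    define w where "w = v + u"
    have Ppos: "?P > 0"
      by (intro prod_pos) (auto simp: add_pos_nonneg)
    have "norm v \<le> norm w + norm u"
      unfolding w_def by (metis add_diff_cancel_right' norm_triangle_ineq4)
    also have "\<dots> \<le> norm w + 1"
      using that by simp
    also have "1 + (norm w + 1) \<le> 2 * (1 + norm w)"
      by simp
    finally have w: "1 + norm v \<le> 2 * (1 + norm w)"
      by simp
    have "?P \<le> (\<Prod>b\<in>(Basis::'a set). (1 + norm v)\<^sup>2)"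
    proof (intro prod_mono conjI)
      fix b :: 'a assume "b \<in> Basis"
      then have "\<bar>v \<bullet> b\<bar> \<le> norm v"
        by (rule Basis_le_norm)
      then have "(v \<bullet> b)\<^sup>2 \<le> (norm v)\<^sup>2"
        by (metis abs_ge_zero power2_abs power_mono)
      then show "1 + (v \<bullet> b)\<^sup>2 \<le> (1 + norm v)\<^sup>2"
        by (simp add: power2_sum add_increasing2)
    qed auto
    also have "\<dots> = (1 + norm v) ^ m"
      by (simp add: m_def power_mult)
    also have "\<dots> \<le> (2 * (1 + norm w)) ^ m"
      using w by (intro power_mono) auto
    also have "\<dots> = 2 ^ m * (1 + norm w) ^ m"
      by (simp only: power_mult_distrib)
    finally have "?P * norm (f w) \<le> 2 ^ m * (1 + norm w) ^ m * norm (f w)"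
      by (rule mult_right_mono) simp
    also have "\<dots> \<le> 2 ^ m * C"
      using C[of w] by (simp add: mult.assoc)
    finally have "norm (f w) \<le> C * 2 ^ m * inverse ?P"
      using Ppos by (simp add: field_simps)
    then show ?thesis
      by (simp add: w_def comp_def flip: prod_inversef)
  qed
  then show ?thesis
    using C0 by (intro exI[of _ "C * 2 ^ m"]) auto
qed

lemma rapidly_decreasing_integrable:
  fixes f :: "'a::euclidean_space \<Rightarrow> 'b::{banach, second_countable_topology}"
  assumes "rapidly_decreasing f" and "f \<in> borel_measurable borel"
  shows "integrable lborel f"
proof -
  obtain C where C: "\<And>v u. norm u \<le> 1 \<Longrightarrow> norm (f (v + u)) \<le> C * (\<Prod>b\<in>Basis. inverse (1 + (v \<bullet> b)\<^sup>2))"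
    using rapidly_decreasing_bound[OF assms(1)] by blast
  show ?thesis
  proof (rule Bochner_Integration.integrable_bound)
    show "integrable lborel (\<lambda>v::'a. C * (\<Prod>b\<in>Basis. inverse (1 + (v \<bullet> b)\<^sup>2)))"
      by (intro integrable_mult_right integrable_prod_inverse_1_plus_square)
    show "AE v in lborel. norm (f v) \<le> norm (C * (\<Prod>b\<in>Basis. inverse (1 + (v \<bullet> b)\<^sup>2)))"
    proof (intro AE_I2)
      fix v
      show "norm (f v) \<le> norm (C * (\<Prod>b\<in>Basis. inverse (1 + (v \<bullet> b)\<^sup>2)))"
        using C[of 0 v] by (simp add: abs_if split: if_splits)
    qed
  qed (use assms in simp)
qed

lemma has_vector_derivative_partial_deriv:
  fixes f :: "real ^ 'n::finite \<Rightarrow> complex"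
  assumes "\<And>x. f differentiable (at x)"
  shows "((\<lambda>t. f (v + t *\<^sub>R axis i 1)) has_vector_derivative partial_deriv i f (v + t *\<^sub>R axis i 1)) (at t)"
proof -
  let ?x = "v + t *\<^sub>R axis i 1 :: real ^ 'n"
  obtain D where D: "(f has_derivative D) (at ?x)"
    using assms unfolding differentiable_def by blast
  then interpret D: bounded_linear D
    by (rule has_derivative_bounded_linear)
  have comp: "((\<lambda>s. f (w + s *\<^sub>R axis i 1)) has_vector_derivative D (axis i 1)) (at s0)"
    if "w + s0 *\<^sub>R axis i 1 = ?x" for w s0
  proof -
    have "((\<lambda>s. w + s *\<^sub>R axis i 1) has_derivative (\<lambda>s. s *\<^sub>R axis i 1)) (at s0)"
      by (auto intro!: derivative_eq_intros)
    from has_derivative_compose[OF this, of f D] D that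
    show ?thesis
      by (simp add: has_vector_derivative_def D.scaleR)
  qed
  have "partial_deriv i f ?x = D (axis i 1)"
    unfolding partial_deriv_def by (rule vector_derivative_at) (rule comp, simp)
  then show ?thesis
    using comp[of v t] by simp
qed

lemma has_vector_derivative_imp_difference_quotient_tendsto:
  fixes g :: "real \<Rightarrow> 'b::real_normed_vector"
  assumes "(g has_vector_derivative D) (at 0)"
  shows "((\<lambda>t. (g t - g 0) /\<^sub>R t) \<longlongrightarrow> D) (at 0)"
proof -
  have lim: "((\<lambda>t. norm (g t - g 0 - t *\<^sub>R D) / norm t) \<longlongrightarrow> 0) (at 0)"
    using assms by (simp add: has_vector_derivative_def has_derivative_at)
  have eq: "norm (g t - g 0 - t *\<^sub>R D) / norm t = norm ((g t - g 0) /\<^sub>R t - D)"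
    if "t \<noteq> 0" for t
  proof -
    have "(g t - g 0) /\<^sub>R t - D = (g t - g 0 - t *\<^sub>R D) /\<^sub>R t"
      using that by (simp add: scaleR_right_diff_distrib)
    then show ?thesis
      by (simp only: norm_scaleR) (simp add: divide_inverse mult.commute)
  qed
  have "\<forall>\<^sub>F t in at 0. norm (g t - g 0 - t *\<^sub>R D) / norm t = norm ((g t - g 0) /\<^sub>R t - D)"
    unfolding eventually_at_filter by (intro always_eventually allI impI eq)
  with lim have "((\<lambda>t. norm ((g t - g 0) /\<^sub>R t - D)) \<longlongrightarrow> 0) (at 0)"
    by (rule Lim_transform_eventually)
  then show ?thesis
    by (rule LIM_zero_cancel[OF tendsto_norm_zero_cancel])
qed

lemma difference_quotient_bound:
  fixes f :: "real ^ 'n::finite \<Rightarrow> complex"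
  assumes "\<And>x. f differentiable (at x)" and "h > 0"
    and "\<And>t. 0 \<le> t \<Longrightarrow> t \<le> h \<Longrightarrow> norm (partial_deriv i f (v + t *\<^sub>R axis i 1)) \<le> B"
  shows "norm ((f (v + h *\<^sub>R axis i 1) - f v) /\<^sub>R h) \<le> B"
proof -
  have "norm (f (v + h *\<^sub>R axis i 1) - f (v + 0 *\<^sub>R axis i 1)) \<le> B * norm (h - 0)"
  proof (rule differentiable_bound[of "{0..h}" "\<lambda>t. f (v + t *\<^sub>R axis i 1)"
        "\<lambda>t s. s *\<^sub>R partial_deriv i f (v + t *\<^sub>R axis i 1)" B h 0])
    fix t assume t: "t \<in> {0..h}"
    show "((\<lambda>t. f (v + t *\<^sub>R axis i 1)) has_derivative
        (\<lambda>s. s *\<^sub>R partial_deriv i f (v + t *\<^sub>R axis i 1))) (at t within {0..h})"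
      using has_vector_derivative_partial_deriv[OF assms(1), of v i t]
      unfolding has_vector_derivative_def by (rule has_derivative_at_withinI)
    show "onorm (\<lambda>s. s *\<^sub>R partial_deriv i f (v + t *\<^sub>R axis i 1)) \<le> B"
      using t assms(3)[of t] by (intro onorm_le) (auto simp: mult.commute[of B] intro!: mult_left_mono)
  qed (use assms in auto)
  then have "norm (f (v + h *\<^sub>R axis i 1) - f v) \<le> B * h"
    using assms(2) by simp
  with assms(2) show ?thesis
    by (simp only: norm_scaleR) (simp add: field_simps)
qed

lemma fourier_real_translate:
  fixes f :: "real ^ 'n::finite \<Rightarrow> complex"
  assumes "f \<in> borel_measurable borel"
  shows "fourier_real (\<lambda>v. f (v + a)) y = exp (2 * of_real pi * \<i> * of_real (a \<bullet> y)) * fourier_real f y"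
proof -
  have "fourier_real f y
      = (\<integral>v. f v * exp (- 2 * of_real pi * \<i> * of_real (v \<bullet> y)) \<partial>distr lborel borel ((+) a))"
    unfolding fourier_real_def lborel_distr_plus ..
  also have "\<dots> = (\<integral>v. f (a + v) * exp (- 2 * of_real pi * \<i> * of_real ((a + v) \<bullet> y)) \<partial>lborel)"
    using assms by (intro integral_distr) auto
  also have "\<dots> = (\<integral>v. exp (- 2 * of_real pi * \<i> * of_real (a \<bullet> y)) *
       (f (v + a) * exp (- 2 * of_real pi * \<i> * of_real (v \<bullet> y))) \<partial>lborel)"
    by (intro Bochner_Integration.integral_cong refl)
       (simp add: inner_add_left algebra_simps flip: exp_add)
  also have "\<dots> = exp (- 2 * of_real pi * \<i> * of_real (a \<bullet> y)) * fourier_real (\<lambda>v. f (v + a)) y"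
    unfolding fourier_real_def by (rule integral_mult_right_zero)
  finally show ?thesis
    by (simp add: exp_minus field_simps)
qed

lemma norm_fourier_real_le:
  "norm (fourier_real f y) \<le> (\<integral>v. norm (f v) \<partial>lborel)"
proof -
  have "norm (fourier_real f y)
      \<le> (\<integral>v. norm (f v * exp (- 2 * of_real pi * \<i> * of_real (v \<bullet> y))) \<partial>lborel)"
    unfolding fourier_real_def by (rule integral_norm_bound)
  also have "\<dots> = (\<integral>v. norm (f v) \<partial>lborel)"
    by (simp add: norm_mult norm_exp_eq_Re)
  finally show ?thesis .
qed

text \<open>
  By \<open>fourier_real_translate\<close>, the difference quotient of \<open>f\<close> in direction \<open>axis i 1\<close> with step \<open>h\<close>
  has the Fourier transform \<open>(exp(2 \<pi> \<i> h y\<^sub>i) - 1) / h\<close> times that of \<open>f\<close>.  As \<open>h\<close> tends to 0, the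
  factor tends to \<open>2 \<pi> \<i> y\<^sub>i\<close>, while by dominated convergence the transform of the difference
  quotient tends to that of the partial derivative.
\<close>
lemma fourier_real_partial_deriv:
  fixes f :: "real ^ 'n::finite \<Rightarrow> complex"
  assumes diff: "\<And>x. f differentiable (at x)"
    and diff': "\<And>x. partial_deriv i f differentiable (at x)"
    and dec: "rapidly_decreasing f"
    and dec': "rapidly_decreasing (partial_deriv i f)"
  shows "fourier_real (partial_deriv i f) y = 2 * of_real pi * \<i> * of_real (y $ i) * fourier_real f y"
proof -
  let ?e = "axis i 1 :: real ^ 'n"
  let ?E = "\<lambda>v::real ^ 'n. exp (- 2 * of_real pi * \<i> * of_real (v \<bullet> y))"
  define h :: "nat \<Rightarrow> real" where "h n = 1 / real (Suc n)" for n
  have h: "h n > 0" "h n \<le> 1" for n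
    by (simp_all add: h_def)
  have "h \<longlonglongrightarrow> 0"
    unfolding h_def using lim_1_over_n[THEN LIMSEQ_Suc] by simp
  then have h_lim: "filterlim h (at 0) sequentially"
    by (rule filterlim_atI) (simp add: h_def)
  have meas [measurable]: "f \<in> borel_measurable borel" "partial_deriv i f \<in> borel_measurable borel"
    by (intro borel_measurable_continuous_onI continuous_at_imp_continuous_on ballI
        differentiable_imp_continuous_within diff diff')+
  have intE: "integrable lborel (\<lambda>v. g v * ?E v)"
    if "integrable lborel g" for g :: "real ^ 'n \<Rightarrow> complex"
  proof (rule Bochner_Integration.integrable_bound[OF that])
    show "(\<lambda>v. g v * ?E v) \<in> borel_measurable lborel"
      using borel_measurable_integrable[OF that] by simp
  qed (simp add: norm_mult norm_exp_eq_Re)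
  have int: "integrable lborel f"
    using dec meas(1) by (rule rapidly_decreasing_integrable)
  have int_shift: "integrable lborel (\<lambda>v. f (v + a))" for a
    using int integrable_distr_eq[of "(+) a" lborel borel f]
    by (simp add: lborel_distr_plus add.commute)
  let ?s = "\<lambda>n v. ((f (v + h n *\<^sub>R ?e) - f v) /\<^sub>R h n) * ?E v"
  obtain C where C: "\<And>v u. norm u \<le> 1 \<Longrightarrow>
      norm (partial_deriv i f (v + u)) \<le> C * (\<Prod>b\<in>Basis. inverse (1 + (v \<bullet> b)\<^sup>2))"
    using rapidly_decreasing_bound[OF dec'] by blast
  have lim: "(\<lambda>n. \<integral>v. ?s n v \<partial>lborel) \<longlonglongrightarrow> (\<integral>v. partial_deriv i f v * ?E v \<partial>lborel)"
  proof (rule integral_dominated_convergence[where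
        w = "\<lambda>v. C * (\<Prod>b\<in>Basis. inverse (1 + (v \<bullet> b)\<^sup>2))"])
    show "integrable lborel (\<lambda>v::real^'n. C * (\<Prod>b\<in>Basis. inverse (1 + (v \<bullet> b)\<^sup>2)))"
      by (intro integrable_mult_right integrable_prod_inverse_1_plus_square)
    show "AE v in lborel. (\<lambda>n. ?s n v) \<longlonglongrightarrow> partial_deriv i f v * ?E v"
    proof (intro AE_I2 tendsto_mult_right)
      fix v
      have "((\<lambda>t. (f (v + t *\<^sub>R ?e) - f v) /\<^sub>R t) \<longlongrightarrow> partial_deriv i f v) (at 0)"
        using has_vector_derivative_imp_difference_quotient_tendsto[OF
            has_vector_derivative_partial_deriv[OF diff, of v i 0, simplified]]
        by simp
      then show "(\<lambda>n. (f (v + h n *\<^sub>R ?e) - f v) /\<^sub>R h n) \<longlonglongrightarrow> partial_deriv i f v"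
        by (rule filterlim_compose[OF _ h_lim])
    qed
    show "AE v in lborel. norm (?s n v) \<le> C * (\<Prod>b\<in>Basis. inverse (1 + (v \<bullet> b)\<^sup>2))" for n
    proof (intro AE_I2)
      fix v
      have "norm ((f (v + h n *\<^sub>R ?e) - f v) /\<^sub>R h n)
          \<le> C * (\<Prod>b\<in>Basis. inverse (1 + (v \<bullet> b)\<^sup>2))"
        using h(2)[of n] by (intro difference_quotient_bound[OF diff h(1)] C) auto
      then show "norm (?s n v) \<le> C * (\<Prod>b\<in>Basis. inverse (1 + (v \<bullet> b)\<^sup>2))"
        by (simp add: norm_mult norm_exp_eq_Re)
    qed
  qed (use meas in simp_all)
  have eq: "(\<integral>v. ?s n v \<partial>lborel)
      = (exp (2 * of_real pi * \<i> * of_real (h n * y $ i)) - 1) / of_real (h n) * fourier_real f y" for n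
  proof -
    have "(\<integral>v. ?s n v \<partial>lborel)
        = (\<integral>v. (f (v + h n *\<^sub>R ?e) * ?E v - f v * ?E v) /\<^sub>R h n \<partial>lborel)"
      by (simp add: left_diff_distrib)
    also have "\<dots> = (fourier_real (\<lambda>v. f (v + h n *\<^sub>R ?e)) y - fourier_real f y) /\<^sub>R h n"
      unfolding fourier_real_def using intE[OF int] intE[OF int_shift]
      by (subst integral_scaleR_right) simp_all
    also have "fourier_real (\<lambda>v. f (v + h n *\<^sub>R ?e)) y
        = exp (2 * of_real pi * \<i> * of_real (h n * y $ i)) * fourier_real f y"
      by (simp add: fourier_real_translate[OF meas(1)] inner_axis')
    also have "(E * F - F) /\<^sub>R r = (E - 1) / of_real r * F" for E F :: complex and r
      by (simp add: scaleR_conv_of_real field_simps)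
    finally show ?thesis .
  qed
  let ?c = "2 * of_real pi * \<i> * of_real (y $ i) :: complex"
  have "((\<lambda>z. exp (?c * z)) has_field_derivative ?c) (at (of_real 0))"
    by (auto intro!: derivative_eq_intros)
  from has_vector_derivative_imp_difference_quotient_tendsto[OF has_vector_derivative_real_field[OF this]]
  have "((\<lambda>t. (exp (2 * of_real pi * \<i> * of_real (t * y $ i)) - 1) / of_real t) \<longlongrightarrow> ?c) (at (0::real))"
    by (simp add: scaleR_conv_of_real divide_inverse_commute mult_ac)
  from tendsto_mult_right[OF filterlim_compose[OF this h_lim], of "fourier_real f y"]
  have "(\<lambda>n. \<integral>v. ?s n v \<partial>lborel) \<longlonglongrightarrow> 2 * of_real pi * \<i> * of_real (y $ i) * fourier_real f y"
    unfolding eq .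
  with lim show ?thesis
    unfolding fourier_real_def[of "partial_deriv i f"] by (rule LIMSEQ_unique)
qed

text \<open>
  The seminorms of a Schwartz function use \<open>norm x ^ k\<close>, which says nothing near 0; combining the
  exponents \<open>0\<close> and \<open>k\<close> gives the bound with \<open>(1 + norm x) ^ k\<close>.
\<close>
lemma schwartz_iter_rapidly_decreasing:
  assumes "schwartz f"
  shows "rapidly_decreasing (iter_partial_deriv js f)"
  unfolding rapidly_decreasing_def
proof
  fix k :: nat
  obtain A B where A: "\<And>x. norm x ^ 0 * norm (iter_partial_deriv js f x) \<le> A"
    and B: "\<And>x. norm x ^ k * norm (iter_partial_deriv js f x) \<le> B"
    using assms unfolding schwartz_def by metis
  have "(1 + norm x) ^ k * norm (iter_partial_deriv js f x) \<le> 2 ^ k * (A + B)" for x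
  proof -
    have "(1 + norm x) ^ k \<le> (2 * max 1 (norm x)) ^ k"
      by (intro power_mono) auto
    also have "\<dots> = 2 ^ k * max 1 (norm x) ^ k"
      by (rule power_mult_distrib)
    also have "\<dots> \<le> 2 ^ k * (1 + norm x ^ k)"
      by (intro mult_left_mono) (auto simp: max_def)
    finally have "(1 + norm x) ^ k * norm (iter_partial_deriv js f x)
        \<le> 2 ^ k * (1 + norm x ^ k) * norm (iter_partial_deriv js f x)"
      by (rule mult_right_mono) simp
    also have "\<dots> = 2 ^ k * (norm x ^ 0 * norm (iter_partial_deriv js f x)
        + norm x ^ k * norm (iter_partial_deriv js f x))"
      by (simp add: algebra_simps)
    also have "\<dots> \<le> 2 ^ k * (A + B)"
      by (intro mult_left_mono add_mono A B) simp
    finally show ?thesis .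
  qed
  then show "\<exists>C. \<forall>x. (1 + norm x) ^ k * norm (iter_partial_deriv js f x) \<le> C"
    by blast
qed

lemma schwartz_partial_deriv:
  assumes "schwartz f"
  shows "schwartz (partial_deriv i f)"
proof -
  have "iter_partial_deriv js (partial_deriv i f) = iter_partial_deriv (js @ [i]) f" for js
    by (simp add: iter_partial_deriv_def)
  then show ?thesis
    using assms by (simp add: schwartz_def)
qed

text \<open>
  Each factor \<open>y\<^sub>i\<close> is exchanged for one more partial derivative of \<open>f\<close>, which is again Schwartz;
  after \<open>k\<close> exchanges the trivial bound by the \<open>L\<^sup>1\<close> norm remains.
\<close>
lemma fourier_real_decay_coordinate:
  fixes f :: "real ^ 'n::finite \<Rightarrow> complex"
  assumes "schwartz f"
  shows "\<exists>C. \<forall>y. \<bar>y $ i\<bar> ^ k * norm (fourier_real f y) \<le> C"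
  using assms
proof (induction k arbitrary: f)
  case 0
  then show ?case
    using norm_fourier_real_le[of f] by auto
next
  case (Suc k)
  have "iter_partial_deriv [] f = f" "iter_partial_deriv [i] f = partial_deriv i f"
    by (simp_all add: iter_partial_deriv_def)
  then have eq: "fourier_real (partial_deriv i f) y
      = 2 * of_real pi * \<i> * of_real (y $ i) * fourier_real f y" for y
    using Suc.prems schwartz_iter_rapidly_decreasing[OF Suc.prems]
    by (intro fourier_real_partial_deriv) (metis schwartz_def)+
  obtain C where C: "\<And>y. \<bar>y $ i\<bar> ^ k * norm (fourier_real (partial_deriv i f) y) \<le> C"
    using Suc.IH[OF schwartz_partial_deriv[OF Suc.prems]] by blast
  have "\<bar>y $ i\<bar> ^ Suc k * norm (fourier_real f y) \<le> C / (2 * pi)" for y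
    using C[of y] by (simp add: eq norm_mult field_simps)
  then show ?case
    by blast
qed

lemma fourier_real_decay:
  fixes f :: "real ^ 'n::finite \<Rightarrow> complex"
  assumes "schwartz f"
  obtains C where "C \<ge> 0" and "\<And>y i. \<bar>y $ i\<bar> ^ k * norm (fourier_real f y) \<le> C"
proof -
  have "\<forall>i. \<exists>C. \<forall>y. \<bar>y $ i\<bar> ^ k * norm (fourier_real f y) \<le> C"
    by (intro allI fourier_real_decay_coordinate assms)
  from choice[OF this] obtain C where C: "\<And>y i. \<bar>y $ i\<bar> ^ k * norm (fourier_real f y) \<le> C i"
    by auto
  have C0: "C i \<ge> 0" for i
    using order_trans[OF _ C[of 0 i]] by simp
  show thesis
  proof (rule that)
    show "\<bar>y $ i\<bar> ^ k * norm (fourier_real f y) \<le> sum C UNIV" for y i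
      using C[of y i] member_le_sum[of i UNIV C] C0 by fastforce
    show "sum C UNIV \<ge> 0"
      using C0 by (simp add: sum_nonneg)
  qed
qed

section \<open>Summation over the dual lattice\<close>

text \<open>
  Replaces the inverse power \<open>2 r\<close> of the sup norm in lattice sums: it is at least that power on
  nonzero vectors (\<open>lattice_weight_lower_bound\<close>), and because it separates the coordinates, its sum
  factors into one-dimensional sums.
\<close>
definition lattice_weight :: "int ^ 'n::finite \<Rightarrow> real" where
  "lattice_weight x = (\<Prod>i\<in>UNIV. 2 / (1 + (real_of_int (x $ i))\<^sup>2))"

definition lattice_box :: "real \<Rightarrow> (int ^ 'n::finite) set" where
  "lattice_box Z = {x. x \<noteq> 0 \<and> (\<forall>i. \<bar>real_of_int (x $ i)\<bar> \<le> Z)}"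

lemma vec_lambda_PiE_image:
  "{x :: 'a ^ 'n::finite. \<forall>i. x $ i \<in> B} = vec_lambda ` (UNIV \<rightarrow>\<^sub>E B)"
proof (intro equalityI subsetI)
  fix x :: "'a ^ 'n" assume "x \<in> {x. \<forall>i. x $ i \<in> B}"
  then show "x \<in> vec_lambda ` (UNIV \<rightarrow>\<^sub>E B)"
    by (intro image_eqI[of _ _ "vec_nth x"]) auto
qed auto

lemma
  assumes "finite B"
  shows finite_vecs_in: "finite {x :: 'a ^ 'n::finite. \<forall>i. x $ i \<in> B}"
    and card_vecs_in_le: "card {x :: 'a ^ 'n::finite. \<forall>i. x $ i \<in> B} \<le> card B ^ CARD('n)"
proof -
  have fin: "finite ((UNIV :: 'n set) \<rightarrow>\<^sub>E B)"
    using assms by (intro finite_PiE) auto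
  then show "finite {x :: 'a ^ 'n. \<forall>i. x $ i \<in> B}"
    unfolding vec_lambda_PiE_image by (rule finite_imageI)
  have "card {x :: 'a ^ 'n. \<forall>i. x $ i \<in> B} \<le> card ((UNIV :: 'n set) \<rightarrow>\<^sub>E B)"
    unfolding vec_lambda_PiE_image using fin by (rule card_image_le)
  then show "card {x :: 'a ^ 'n. \<forall>i. x $ i \<in> B} \<le> card B ^ CARD('n)"
    by (simp add: card_PiE)
qed

lemma finite_lattice_box: "finite (lattice_box Z :: (int ^ 'n::finite) set)"
proof (rule finite_subset)
  show "lattice_box Z \<subseteq> {x :: int ^ 'n. \<forall>i. x $ i \<in> {- \<lceil>Z\<rceil>..\<lceil>Z\<rceil>}}"
  proof
    fix x :: "int ^ 'n" assume "x \<in> lattice_box Z"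
    then have Z: "\<bar>real_of_int (x $ i)\<bar> \<le> Z" for i
      by (simp add: lattice_box_def)
    have "real_of_int \<bar>x $ i\<bar> \<le> real_of_int \<lceil>Z\<rceil>" for i
      using order_trans[OF Z le_of_int_ceiling] by simp
    then have "\<bar>x $ i\<bar> \<le> \<lceil>Z\<rceil>" for i
      by (simp only: of_int_le_iff)
    then have "x $ i \<in> {- \<lceil>Z\<rceil>..\<lceil>Z\<rceil>}" for i
      unfolding atLeastAtMost_iff by (metis abs_le_iff minus_le_iff)
    then show "x \<in> {x. \<forall>i. x $ i \<in> {- \<lceil>Z\<rceil>..\<lceil>Z\<rceil>}}"
      by simp
  qed
qed (rule finite_vecs_in, simp)

lemma norm_fourier_mod_le_1:
  fixes f :: "int ^ 'n::finite \<Rightarrow> complex"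
  assumes "q > 0" and "\<And>x. norm (f x) \<le> 1"
  shows "norm (fourier_mod q f x) \<le> 1"
proof -
  have res: "residue_vecs q = {x :: int ^ 'n. \<forall>i. x $ i \<in> {0..<int q}}"
    by (auto simp: residue_vecs_def)
  let ?e = "\<lambda>x'. exp (2 * of_real pi * \<i> * of_int (scalar_product x' x) / of_nat q) :: complex"
  have e: "norm (?e x') = 1" for x'
  proof -
    have "?e x' = exp (\<i> * of_real (2 * pi * of_int (scalar_product x' x) / of_nat q))"
      by (simp add: mult_ac)
    then show ?thesis
      by (simp only: norm_exp_i_times)
  qed
  have "norm (\<Sum>x' \<in> residue_vecs q. f x' * ?e x') \<le> real (card (residue_vecs q :: (int ^ 'n) set)) * 1"
    using assms(2) by (intro sum_norm_bound) (simp add: norm_mult e)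
  also have "\<dots> \<le> real (q ^ CARD('n))"
    using card_vecs_in_le[of "{0..<int q}", where 'n = 'n] unfolding res by simp
  finally show ?thesis
    using assms(1) by (simp add: fourier_mod_def norm_divide norm_power divide_le_eq)
qed

lemma lattice_weight_nonneg: "lattice_weight x \<ge> 0"
  unfolding lattice_weight_def by (intro prod_nonneg) auto

lemma summable_on_inverse_1_plus_square_int:
  "(\<lambda>k::int. 2 / (1 + (real_of_int k)\<^sup>2)) summable_on UNIV"
proof -
  let ?g = "\<lambda>k::int. 2 / (1 + (real_of_int k)\<^sup>2)"
  have "summable (\<lambda>n. 2 / (1 + (real n)\<^sup>2))"
  proof (rule summable_comparison_test_bigo)
    show "summable (\<lambda>n. norm (1 / real n ^ 2))"
      using inverse_power_summable[of 2, where 'a = real] by (simp add: inverse_eq_divide)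
    show "(\<lambda>n. 2 / (1 + (real n)\<^sup>2)) \<in> O(\<lambda>n. 1 / real n ^ 2)"
    proof (rule bigoI[of _ 2])
      show "\<forall>\<^sub>F n in sequentially. norm (2 / (1 + (real n)\<^sup>2)) \<le> 2 * norm (1 / real n ^ 2)"
        using eventually_gt_at_top[of 0]
        by eventually_elim (auto simp: frac_le)
    qed
  qed
  then have nat: "(\<lambda>n. 2 / (1 + (real n)\<^sup>2)) summable_on UNIV"
    by (subst summable_on_UNIV_nonneg_real_iff) auto
  have "?g summable_on range int"
    using nat by (subst summable_on_reindex) (auto simp: o_def)
  moreover have "?g summable_on range (\<lambda>n. - int n)"
    using nat by (subst summable_on_reindex) (auto simp: o_def inj_on_def)
  ultimately have "?g summable_on (range int \<union> range (\<lambda>n. - int n))"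
    by (rule summable_on_union)
  also have "range int \<union> range (\<lambda>n. - int n) = UNIV"
    by (auto intro: int_cases2)
  finally show ?thesis .
qed

lemma summable_on_lattice_weight: "lattice_weight summable_on (UNIV :: (int ^ 'n::finite) set)"
proof -
  let ?g = "\<lambda>k::int. 2 / (1 + (real_of_int k)\<^sup>2)"
  have "Infinite_Set_Sum.abs_summable_on ?g UNIV"
    using summable_on_inverse_1_plus_square_int
    unfolding abs_summable_equivalent[symmetric] by simp
  then have "Infinite_Set_Sum.abs_summable_on (\<lambda>g. \<Prod>i\<in>(UNIV::'n set). ?g (g i)) (UNIV \<rightarrow>\<^sub>E UNIV)"
    by (intro abs_summable_on_prod_PiE) auto
  then have "(\<lambda>g. \<Prod>i\<in>(UNIV::'n set). ?g (g i)) summable_on (UNIV :: ('n \<Rightarrow> int) set)"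
    unfolding abs_summable_equivalent[symmetric] by (simp add: abs_prod)
  moreover have "bij (vec_nth :: int ^ 'n \<Rightarrow> _)"
    by (rule bij_betw_byWitness[of _ vec_lambda]) auto
  ultimately have "(\<lambda>x :: int ^ 'n. \<Prod>i\<in>UNIV. ?g (x $ i)) summable_on UNIV"
    using summable_on_reindex_bij_betw by fast
  then show ?thesis
    by (simp only: lattice_weight_def[abs_def])
qed

text \<open>
  If \<open>\<bar>x\<^sub>i\<bar>\<close> is the sup norm of a nonzero \<open>x\<close>, it is at least 1 and hence \<open>1 + x\<^sub>j\<^sup>2 \<le> 2 x\<^sub>i\<^sup>2\<close> for all \<open>j\<close>;
  the product over \<open>j\<close> says that the inverse power \<open>2 r\<close> of the sup norm is at most the weight.
\<close>
lemma lattice_weight_lower_bound: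
  fixes x :: "int ^ 'n::finite"
  assumes "x \<noteq> 0" and max: "\<And>j. \<bar>x $ j\<bar> \<le> \<bar>x $ i\<bar>"
  shows "1 \<le> \<bar>real_of_int (x $ i)\<bar> ^ (2 * CARD('n)) * lattice_weight x"
proof -
  let ?m = "\<bar>real_of_int (x $ i)\<bar>"
  obtain j where "x $ j \<noteq> 0"
    using assms(1) by (auto simp: vec_eq_iff)
  then have "1 \<le> \<bar>x $ i\<bar>"
    using max[of j] by linarith
  then have m: "1 \<le> ?m"
    by linarith
  have "1 \<le> (\<Prod>j\<in>(UNIV::'n set). ?m\<^sup>2 * (2 / (1 + (real_of_int (x $ j))\<^sup>2)))"
  proof (rule prod_ge_1)
    fix j
    have "\<bar>real_of_int (x $ j)\<bar> \<le> ?m"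
      using max[of j] by linarith
    then have "(real_of_int (x $ j))\<^sup>2 \<le> ?m\<^sup>2"
      by (metis abs_ge_zero power2_abs power_mono)
    moreover have "1 \<le> ?m\<^sup>2"
      using m by (rule one_le_power)
    ultimately have "1 + (real_of_int (x $ j))\<^sup>2 \<le> 2 * ?m\<^sup>2"
      by linarith
    then show "1 \<le> ?m\<^sup>2 * (2 / (1 + (real_of_int (x $ j))\<^sup>2))"
      by (simp add: le_divide_eq add_pos_nonneg mult.commute)
  qed
  also have "\<dots> = ?m ^ (2 * CARD('n)) * lattice_weight x"
    unfolding lattice_weight_def prod.distrib by (simp only: prod_constant power_mult)
  finally show ?thesis .
qed

text \<open>
  Decay of order \<open>M + 2 r\<close> in the largest coordinate of \<open>x\<close> is split in two: \<open>M\<close> powers exploit that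
  this coordinate exceeds \<open>Z\<close>, and \<open>2 r\<close> powers make the sum over \<open>x\<close> converge.
\<close>
lemma fourier_real_lattice_tail:
  fixes \<phi> :: "real ^ 'n::finite \<Rightarrow> complex"
  assumes "schwartz \<phi>"
  obtains A where "A \<ge> 0"
    and "\<And>t Z x. t > 0 \<Longrightarrow> Z > 0 \<Longrightarrow> x \<noteq> 0 \<Longrightarrow> x \<notin> lattice_box Z \<Longrightarrow>
      norm (fourier_real \<phi> (t *\<^sub>R real_vec x))
        \<le> A / ((t * Z) ^ M * t ^ (2 * CARD('n))) * lattice_weight x"
proof -
  let ?r = "2 * CARD('n)"
  obtain A where A0: "A \<ge> 0"
    and A: "\<And>y i. \<bar>y $ i\<bar> ^ (M + ?r) * norm (fourier_real \<phi> y) \<le> A"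
    using fourier_real_decay[OF assms, of "M + ?r"] by blast
  have "norm (fourier_real \<phi> (t *\<^sub>R real_vec x)) \<le> A / ((t * Z) ^ M * t ^ ?r) * lattice_weight x"
    if t: "t > 0" and Z: "Z > 0" and x: "x \<noteq> 0" "x \<notin> lattice_box Z" for t Z and x :: "int ^ 'n"
  proof -
    obtain i where i: "\<And>j. \<bar>x $ j\<bar> \<le> \<bar>x $ i\<bar>"
    proof -
      have "Max (range (\<lambda>j. \<bar>x $ j\<bar>)) \<in> range (\<lambda>j. \<bar>x $ j\<bar>)"
        by (intro Max_in) auto
      then obtain i where "Max (range (\<lambda>j. \<bar>x $ j\<bar>)) = \<bar>x $ i\<bar>"
        by blast
      then show thesis
        by (intro that[of i]) (metis Max_ge finite finite_imageI rangeI)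
    qed
    define m where "m = \<bar>real_of_int (x $ i)\<bar>"
    obtain j where "\<bar>real_of_int (x $ j)\<bar> > Z"
      using x by (auto simp: lattice_box_def not_le)
    moreover have "\<bar>real_of_int (x $ j)\<bar> \<le> m"
      using i[of j] unfolding m_def by linarith
    ultimately have mZ: "Z \<le> m"
      by linarith
    with Z have m0: "m > 0"
      by linarith
    let ?F = "norm (fourier_real \<phi> (t *\<^sub>R real_vec x))"
    have W: "1 \<le> m ^ ?r * lattice_weight x"
      unfolding m_def using x(1) i by (rule lattice_weight_lower_bound)
    have "\<bar>(t *\<^sub>R real_vec x) $ i\<bar> = t * m"
      using t by (simp add: real_vec_def m_def abs_mult)
    with A[of "t *\<^sub>R real_vec x" i] have "(t * m) ^ M * (t * m) ^ ?r * ?F \<le> A"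
      by (simp add: power_add)
    moreover have "(t * Z) ^ M * (t * m) ^ ?r * ?F \<le> (t * m) ^ M * (t * m) ^ ?r * ?F"
      using t Z m0 mZ by (intro mult_right_mono power_mono mult_left_mono) auto
    ultimately have "((t * Z) ^ M * t ^ ?r) * (m ^ ?r * ?F) \<le> A"
      by (simp add: power_mult_distrib mult_ac)
    then have F: "m ^ ?r * ?F \<le> A / ((t * Z) ^ M * t ^ ?r)"
      using t Z by (simp add: pos_le_divide_eq mult_ac)
    have "?F \<le> (m ^ ?r * lattice_weight x) * ?F"
      using mult_right_mono[OF W, of ?F] by simp
    also have "\<dots> = (m ^ ?r * ?F) * lattice_weight x"
      by (simp only: mult_ac)
    also have "\<dots> \<le> A / ((t * Z) ^ M * t ^ ?r) * lattice_weight x"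
      using F lattice_weight_nonneg by (rule mult_right_mono)
    finally show ?thesis .
  qed
  with A0 show thesis
    by (rule that)
qed

text \<open>
  Inside the box the coefficients are kept, because the sum of their absolute values is what the
  hypothesis of the theorem controls; outside it only their bound by 1 is used, the decay of the Fourier transform
  being strong enough by itself.
\<close>
lemma fourier_lattice_sum_bound:
  fixes \<phi> :: "real ^ 'n::finite \<Rightarrow> complex"
  assumes "schwartz \<phi>"
  obtains A B where "A \<ge> 0" and "B \<ge> 0"
    and "\<And>t Z (a :: int ^ 'n \<Rightarrow> complex). t > 0 \<Longrightarrow> Z > 0 \<Longrightarrow> (\<And>x. norm (a x) \<le> 1) \<Longrightarrow>
      norm (\<Sum>\<^sub>\<infinity>x \<in> {x. x \<noteq> 0}. a x * fourier_real \<phi> (t *\<^sub>R real_vec x))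
        \<le> A * (\<Sum>x\<in>lattice_box Z. norm (a x)) + B / ((t * Z) ^ M * t ^ (2 * CARD('n)))"
proof -
  let ?r = "2 * CARD('n)"
  obtain B0 where B0: "B0 \<ge> 0"
    and tail: "\<And>t Z x. t > 0 \<Longrightarrow> Z > 0 \<Longrightarrow> x \<noteq> 0 \<Longrightarrow> x \<notin> lattice_box Z \<Longrightarrow>
      norm (fourier_real \<phi> (t *\<^sub>R real_vec x)) \<le> B0 / ((t * Z) ^ M * t ^ ?r) * lattice_weight x"
    using fourier_real_lattice_tail[OF assms] by blast
  obtain A where A0: "A \<ge> 0" and A: "\<And>y (i::'n). \<bar>y $ i\<bar> ^ 0 * norm (fourier_real \<phi> y) \<le> A"
    using fourier_real_decay[OF assms, of 0] by blast
  define S where "S = infsum lattice_weight (UNIV :: (int ^ 'n) set)"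
  have S0: "S \<ge> 0"
    unfolding S_def by (intro infsum_nonneg lattice_weight_nonneg)
  have "norm (\<Sum>\<^sub>\<infinity>x \<in> {x. x \<noteq> 0}. a x * fourier_real \<phi> (t *\<^sub>R real_vec x))
      \<le> A * (\<Sum>x\<in>lattice_box Z. norm (a x)) + (B0 * S) / ((t * Z) ^ M * t ^ ?r)"
    if t: "t > 0" and Z: "Z > 0" and a: "\<And>x. norm (a x) \<le> 1" for t Z and a :: "int ^ 'n \<Rightarrow> complex"
  proof -
    define D where "D = B0 / ((t * Z) ^ M * t ^ ?r)"
    have D0: "D \<ge> 0"
      using t Z B0 by (simp add: D_def)
    let ?near = "\<lambda>x. A * (if x \<in> lattice_box Z then norm (a x) else 0)"
    let ?far = "\<lambda>x :: int ^ 'n. D * lattice_weight x"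
    let ?T = "\<lambda>x. a x * fourier_real \<phi> (t *\<^sub>R real_vec x)"
    have near_sum: "(?near has_sum A * (\<Sum>x\<in>lattice_box Z. norm (a x))) UNIV"
    proof (rule has_sum_cmult_right)
      have "((\<lambda>x. if x \<in> lattice_box Z then norm (a x) else 0) has_sum
          (\<Sum>x\<in>lattice_box Z. norm (a x))) (lattice_box Z)"
        by (rule has_sum_finiteI) (auto simp: finite_lattice_box)
      then show "((\<lambda>x. if x \<in> lattice_box Z then norm (a x) else 0) has_sum
          (\<Sum>x\<in>lattice_box Z. norm (a x))) UNIV"
        by (rule has_sum_cong_neutral[THEN iffD1, rotated -1]) auto
    qed
    have far_sum: "(?far has_sum D * S) UNIV"
      unfolding S_def
      by (intro has_sum_cmult_right has_sum_infsum[OF summable_on_lattice_weight])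
    have both: "((\<lambda>x. ?near x + ?far x) has_sum
        A * (\<Sum>x\<in>lattice_box Z. norm (a x)) + D * S) UNIV"
      using near_sum far_sum by (rule has_sum_add)
    have nonneg: "0 \<le> ?near x + ?far x" for x
      using A0 D0 lattice_weight_nonneg[of x] by auto
    have bound: "norm (?T x) \<le> ?near x + ?far x" if "x \<noteq> 0" for x
    proof (cases "x \<in> lattice_box Z")
      case True
      have "norm (fourier_real \<phi> (t *\<^sub>R real_vec x)) \<le> A"
        using A[of "t *\<^sub>R real_vec x" undefined] by simp
      then have "norm (?T x) \<le> norm (a x) * A"
        unfolding norm_mult by (rule mult_left_mono) simp
      moreover have "0 \<le> ?far x"
        using D0 lattice_weight_nonneg[of x] by simp
      ultimately show ?thesis
        using True by (simp add: mult.commute)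
    next
      case False
      have "norm (?T x) \<le> 1 * (D * lattice_weight x)"
        unfolding norm_mult D_def using t Z that False
        by (intro mult_mono a tail) auto
      with False show ?thesis
        by simp
    qed
    have sum_T: "(\<lambda>x. norm (?T x)) summable_on {x. x \<noteq> 0}"
      using summable_on_subset_banach[OF has_sum_imp_summable[OF both], of "{x. x \<noteq> 0}"] bound
      by (rule summable_on_comparison_test) auto
    then have "norm (infsum ?T {x. x \<noteq> 0}) \<le> infsum (\<lambda>x. norm (?T x)) {x. x \<noteq> 0}"
      by (rule norm_infsum_bound)
    also have "infsum (\<lambda>x. norm (?T x)) {x. x \<noteq> 0} \<le> infsum (\<lambda>x. ?near x + ?far x) UNIV"
      using sum_T has_sum_imp_summable[OF both]
      by (rule infsum_mono_neutral) (use bound nonneg in auto)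
    also have "\<dots> = A * (\<Sum>x\<in>lattice_box Z. norm (a x)) + D * S"
      using both by (rule infsumI)
    finally show ?thesis
      by (simp add: D_def)
  qed
  then show thesis
    using A0 B0 S0 by (intro that[of A "B0 * S"]) auto
qed

section \<open>The error term in dyadic blocks\<close>

text \<open>
  The case \<open>t = X\<^bsup>1/d\<^esup> / q\<close>, \<open>Z = 2 N X\<^bsup>\<eta> - 1/d\<^esup>\<close> of \<open>fourier_lattice_sum_bound\<close>.  Here
  \<open>t Z = (2 N / q) X\<^bsup>\<eta>\<^esup> \<ge> X\<^bsup>\<eta>\<^esup>\<close>, which is where \<open>q \<le> 2 N\<close> enters, and \<open>1 / t \<le> q\<close> since \<open>X \<ge> 1\<close>.
\<close>
lemma error_term_bound:
  fixes \<phi> :: "real ^ 'n::finite \<Rightarrow> complex" and d \<eta> :: real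
  assumes "schwartz \<phi>" and "d > 0"
  obtains A B where "A \<ge> 0" and "B \<ge> 0"
    and "\<And>X N q (f :: int ^ 'n \<Rightarrow> complex). 1 \<le> X \<Longrightarrow> 0 < N \<Longrightarrow> N \<le> real q \<Longrightarrow> real q \<le> 2 * N \<Longrightarrow>
      (\<And>x. norm (f x) \<le> 1) \<Longrightarrow>
      norm (error_term d X q f \<phi>) \<le> X powr (real CARD('n) / d) *
        (A * (\<Sum>x\<in>lattice_box (2 * N * X powr (\<eta> - 1 / d)). norm (fourier_mod q f x))
         + B * X powr (- \<eta> * real M) * real q ^ (2 * CARD('n)))"
proof -
  let ?r = "2 * CARD('n)"
  obtain A B where AB: "A \<ge> 0" "B \<ge> 0"
    and bound: "\<And>t Z (a :: int ^ 'n \<Rightarrow> complex). t > 0 \<Longrightarrow> Z > 0 \<Longrightarrow> (\<And>x. norm (a x) \<le> 1) \<Longrightarrow>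
      norm (\<Sum>\<^sub>\<infinity>x \<in> {x. x \<noteq> 0}. a x * fourier_real \<phi> (t *\<^sub>R real_vec x))
        \<le> A * (\<Sum>x\<in>lattice_box Z. norm (a x)) + B / ((t * Z) ^ M * t ^ ?r)"
    using fourier_lattice_sum_bound[OF assms(1)] by blast
  have "norm (error_term d X q f \<phi>) \<le> X powr (real CARD('n) / d) *
        (A * (\<Sum>x\<in>lattice_box (2 * N * X powr (\<eta> - 1 / d)). norm (fourier_mod q f x))
         + B * X powr (- \<eta> * real M) * real q ^ ?r)"
    if X: "1 \<le> X" and N: "0 < N" and q: "N \<le> real q" "real q \<le> 2 * N" and f: "\<And>x. norm (f x) \<le> 1"
    for X N q and f :: "int ^ 'n \<Rightarrow> complex"
  proof -
    define t where "t = X powr (1 / d) / real q"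
    define Z where "Z = 2 * N * X powr (\<eta> - 1 / d)"
    have q0: "q > 0"
      using N q(1) by (cases "q = 0") auto
    have t0: "t > 0"
      using X q0 by (simp add: t_def)
    have Z0: "Z > 0"
      using X N by (simp add: Z_def)
    have "t * Z = (2 * N / real q) * (X powr (1 / d) * X powr (\<eta> - 1 / d))"
      by (simp add: t_def Z_def)
    also have "X powr (1 / d) * X powr (\<eta> - 1 / d) = X powr \<eta>"
      by (simp flip: powr_add)
    finally have tZ: "t * Z = (2 * N / real q) * X powr \<eta>" .
    have "1 * X powr \<eta> \<le> t * Z"
      unfolding tZ using q0 q(2) by (intro mult_right_mono) (simp_all add: le_divide_eq)
    then have "(X powr \<eta>) ^ M \<le> (t * Z) ^ M"
      by (intro power_mono) simp_all
    also have "(X powr \<eta>) ^ M = X powr (\<eta> * real M)"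
      using X by (simp add: powr_powr flip: powr_realpow)
    finally have 1: "X powr (\<eta> * real M) \<le> (t * Z) ^ M" .
    have "1 \<le> X powr (1 / d)"
      using X assms(2) by (simp add: ge_one_powr_ge_zero)
    then have "inverse (real q) \<le> t"
      unfolding t_def divide_inverse using q0 by simp
    then have "inverse (real q) ^ ?r \<le> t ^ ?r"
      by (intro power_mono) simp_all
    with 1 have "X powr (\<eta> * real M) * inverse (real q) ^ ?r \<le> (t * Z) ^ M * t ^ ?r"
      by (rule mult_mono) (use t0 Z0 in simp_all)
    then have "B / ((t * Z) ^ M * t ^ ?r) \<le> B / (X powr (\<eta> * real M) * inverse (real q) ^ ?r)"
      using AB X q0 t0 Z0 by (intro divide_left_mono) simp_all
    also have "\<dots> = B * X powr (- \<eta> * real M) * real q ^ ?r"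
      by (simp add: divide_inverse powr_minus power_inverse)
    finally have 2: "B / ((t * Z) ^ M * t ^ ?r) \<le> B * X powr (- \<eta> * real M) * real q ^ ?r" .
    have "norm (\<Sum>\<^sub>\<infinity>x \<in> {x. x \<noteq> 0}. fourier_mod q f x * fourier_real \<phi> (t *\<^sub>R real_vec x))
        \<le> A * (\<Sum>x\<in>lattice_box Z. norm (fourier_mod q f x)) + B / ((t * Z) ^ M * t ^ ?r)"
      using t0 Z0 by (rule bound) (rule norm_fourier_mod_le_1[OF q0 f])
    with 2 have 3: "norm (\<Sum>\<^sub>\<infinity>x \<in> {x. x \<noteq> 0}. fourier_mod q f x * fourier_real \<phi> (t *\<^sub>R real_vec x))
        \<le> A * (\<Sum>x\<in>lattice_box Z. norm (fourier_mod q f x)) + B * X powr (- \<eta> * real M) * real q ^ ?r"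
      by linarith
    have "norm (error_term d X q f \<phi>) = X powr (real CARD('n) / d) *
        norm (\<Sum>\<^sub>\<infinity>x \<in> {x. x \<noteq> 0}. fourier_mod q f x * fourier_real \<phi> (t *\<^sub>R real_vec x))"
      by (simp add: error_term_def t_def norm_mult)
    also have "\<dots> \<le> X powr (real CARD('n) / d) *
        (A * (\<Sum>x\<in>lattice_box Z. norm (fourier_mod q f x)) + B * X powr (- \<eta> * real M) * real q ^ ?r)"
      using 3 by (rule mult_left_mono) simp
    finally show ?thesis
      by (simp only: Z_def)
  qed
  with AB show thesis
    by (rule that)
qed

text \<open>
  Group \<open>q\<close> by \<open>k = \<lfloor>log\<^sub>2 (Y / q)\<rfloor>\<close>, so that \<open>q\<close> lies in \<open>[N, 2 N]\<close> with \<open>N = Y / 2\<^bsup>k+1\<^esup>\<close>.  These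
  values of \<open>N\<close> are halvings of \<open>Y\<close> rather than powers of 2, so that every block satisfies \<open>N < Y\<close>.
\<close>
lemma dyadic_sum_bound:
  fixes F :: "nat \<Rightarrow> real"
  assumes Y: "Y \<ge> 1"
    and nonneg: "\<And>q. F q \<ge> 0"
    and pos: "\<And>q. P q \<Longrightarrow> q > 0"
    and block: "\<And>N. 0 < N \<Longrightarrow> N < Y \<Longrightarrow> (\<Sum>q \<in> {q. P q \<and> N \<le> real q \<and> real q \<le> 2 * N}. F q) \<le> T"
  shows "(\<Sum>q \<in> {q. P q \<and> real q < Y}. F q) \<le> (log 2 Y + 1) * T"
proof -
  define S where "S = {q. P q \<and> real q < Y}"
  define k where "k q = nat \<lfloor>log 2 (Y / real q)\<rfloor>" for q
  define K where "K = nat \<lfloor>log 2 Y\<rfloor> + 1"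
  have fin_le: "finite {q. P q \<and> Q q \<and> real q \<le> B}" for Q B
    by (rule finite_subset[OF _ finite_atMost[of "nat \<lfloor>B\<rfloor>"]]) (auto simp: le_nat_floor)
  have finS: "finite S"
    unfolding S_def by (rule finite_subset[OF _ fin_le[of "\<lambda>_. True" Y]]) auto
  have "0 \<le> (\<Sum>q \<in> {q. P q \<and> Y / 2 \<le> real q \<and> real q \<le> 2 * (Y / 2)}. F q)"
    by (intro sum_nonneg nonneg)
  also have "\<dots> \<le> T"
    by (rule block) (use Y in simp_all)
  finally have T: "T \<ge> 0" .
  have k: "2 ^ k q \<le> Y / real q" "Y / real q < 2 ^ (k q + 1)" "k q < K" if "q \<in> S" for q
  proof -
    have q: "real q \<ge> 1" "real q < Y"
      using that pos[of q] by (auto simp: S_def)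
    then have Yq: "Y / real q > 1"
      by simp
    then have l: "log 2 (Y / real q) > 0"
      by simp
    have "real (k q) \<le> log 2 (Y / real q)"
      using l by (simp add: k_def)
    then show "2 ^ k q \<le> Y / real q"
      using Yq by (simp add: le_log_iff powr_realpow)
    have "log 2 (Y / real q) < real (k q + 1)"
      using l by (simp add: k_def) linarith
    then show "Y / real q < 2 ^ (k q + 1)"
      using Yq by (simp only: log_less_iff powr_realpow)
    have "Y / real q \<le> Y"
      using q Y by (simp add: divide_le_eq mult_le_cancel_left1)
    then have "log 2 (Y / real q) \<le> log 2 Y"
      using Yq by simp
    then show "k q < K"
      unfolding k_def K_def by (simp add: floor_mono nat_mono le_imp_less_Suc)
  qed
  have "(\<Sum>q\<in>S. F q) = (\<Sum>j\<in>{..<K}. \<Sum>q\<in>{q \<in> S. k q = j}. F q)"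
    using finS k(3) by (intro sum.group[symmetric]) auto
  also have "\<dots> \<le> (\<Sum>j\<in>{..<K}. T)"
  proof (rule sum_mono)
    fix j
    define N where "N = Y / 2 ^ (j + 1)"
    have "(1::real) < 2 ^ (j + 1)"
      by (rule one_less_power) simp_all
    then have N: "0 < N" "N < Y"
      using Y by (simp_all add: N_def divide_less_eq)
    have "(\<Sum>q\<in>{q \<in> S. k q = j}. F q) \<le> (\<Sum>q \<in> {q. P q \<and> N \<le> real q \<and> real q \<le> 2 * N}. F q)"
    proof (rule sum_mono2[OF fin_le _ nonneg])
      show "{q \<in> S. k q = j} \<subseteq> {q. P q \<and> N \<le> real q \<and> real q \<le> 2 * N}"
      proof
        fix q assume "q \<in> {q \<in> S. k q = j}"
        then have q: "q \<in> S" "k q = j"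
          by auto
        then have "real q > 0" "P q"
          using pos by (auto simp: S_def)
        with k(1,2)[OF q(1)] show "q \<in> {q. P q \<and> N \<le> real q \<and> real q \<le> 2 * N}"
          by (simp add: q(2) N_def field_simps)
      qed
    qed
    also have "\<dots> \<le> T"
      using N by (rule block)
    finally show "(\<Sum>q\<in>{q \<in> S. k q = j}. F q) \<le> T" .
  qed
  also have "\<dots> = real K * T"
    by simp
  also have "\<dots> \<le> (log 2 Y + 1) * T"
  proof (rule mult_right_mono[OF _ T])
    show "real K \<le> log 2 Y + 1"
      using Y by (simp add: K_def)
  qed
  finally show ?thesis
    by (simp only: S_def)
qed

theorem proposition7:
  fixes d \<alpha> :: real
    and \<Psi> :: "nat \<Rightarrow> int ^ 'n::finite \<Rightarrow> complex"
    and \<phi> :: "real ^ 'n \<Rightarrow> complex"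
  assumes "d > 0"
    and "\<And>q. squarefree q \<Longrightarrow> factors_mod q (\<Psi> q)"
    and "\<And>q x. squarefree q \<Longrightarrow> norm (\<Psi> q x) \<le> 1"
    and "schwartz \<phi>"
    and "\<alpha> > 0"
    and "\<exists>c \<eta> C :: real. c < real CARD('n) / d \<and> \<eta> > 0 \<and>
      (\<forall>X N :: real. 1 \<le> X \<longrightarrow> 0 < N \<longrightarrow> N < X powr \<alpha> \<longrightarrow>
        (let Z = 2 * N * X powr (\<eta> - 1 / d) in
          X powr (real CARD('n) / d) *
          (\<Sum>q \<in> {q :: nat. squarefree q \<and> N \<le> real q \<and> real q \<le> 2 * N}.
             \<Sum>x \<in> {x :: int ^ 'n. x \<noteq> 0 \<and> (\<forall>i. \<bar>real_of_int (x $ i)\<bar> \<le> Z)}.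
               norm (fourier_mod q (\<Psi> q) x))
          \<le> C * X powr c))"
  shows "\<exists>c' C' :: real. c' < real CARD('n) / d \<and>
      (\<forall>X :: real. 1 \<le> X \<longrightarrow>
        (\<Sum>q \<in> {q :: nat. squarefree q \<and> real q < X powr \<alpha>}.
           norm (error_term d X q (\<Psi> q) \<phi>))
        \<le> C' * X powr c')"
proof -
  let ?r = "2 * CARD('n)"
  let ?D = "real CARD('n) / d"
  obtain c \<eta> C :: real where c: "c < ?D" and \<eta>: "\<eta> > 0"
    and hyp: "\<And>X N. 1 \<le> X \<Longrightarrow> 0 < N \<Longrightarrow> N < X powr \<alpha> \<Longrightarrow>
      X powr ?D *
        (\<Sum>q \<in> {q :: nat. squarefree q \<and> N \<le> real q \<and> real q \<le> 2 * N}.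
           \<Sum>x \<in> lattice_box (2 * N * X powr (\<eta> - 1 / d)). norm (fourier_mod q (\<Psi> q) x))
        \<le> C * X powr c"
    using assms(6) unfolding Let_def lattice_box_def by blast
  \<comment> \<open>\<open>M\<close> is large enough for \<open>X\<^bsup>-\<eta> M\<^esup>\<close> to bring the tails of one block to \<open>O(X\<^bsup>c\<^esup>)\<close>: they carry a
    factor \<open>X\<^bsup>r/d\<^esup>\<close>, \<open>2 r\<close> powers of \<open>q \<le> 2 X\<^bsup>\<alpha>\<^esup>\<close>, and one more power for the number of \<open>q\<close>.\<close>
  obtain M :: nat where "((real ?r + 1) * \<alpha> + ?D - c) / \<eta> \<le> real M"
    using real_arch_simple by blast
  then have M: "(real ?r + 1) * \<alpha> + ?D - \<eta> * real M \<le> c"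
    using \<eta> by (simp add: divide_le_eq mult.commute)
  obtain A B where A: "A \<ge> 0" and B: "B \<ge> 0"
    and error: "\<And>X N q (f :: int ^ 'n \<Rightarrow> complex). 1 \<le> X \<Longrightarrow> 0 < N \<Longrightarrow> N \<le> real q \<Longrightarrow> real q \<le> 2 * N \<Longrightarrow>
      (\<And>x. norm (f x) \<le> 1) \<Longrightarrow>
      norm (error_term d X q f \<phi>) \<le> X powr ?D *
        (A * (\<Sum>x\<in>lattice_box (2 * N * X powr (\<eta> - 1 / d)). norm (fourier_mod q f x))
         + B * X powr (- \<eta> * real M) * real q ^ ?r)"
    using error_term_bound[OF assms(4,1)] by blast
  define T where "T = A * \<bar>C\<bar> + B * 2 ^ (?r + 1)"
  have T: "T \<ge> 0"
    using A B by (simp add: T_def)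
  \<comment> \<open>The gap between \<open>c\<close> and \<open>c'\<close> pays for the logarithmic number of blocks.\<close>
  obtain c' where c': "c < c'" "c' < ?D"
    using dense[OF c] by blast
  define \<delta> where "\<delta> = c' - c"
  have \<delta>: "\<delta> > 0"
    using c' by (simp add: \<delta>_def)
  have block: "(\<Sum>q \<in> {q. squarefree q \<and> N \<le> real q \<and> real q \<le> 2 * N}. norm (error_term d X q (\<Psi> q) \<phi>))
      \<le> T * X powr c"
    if X: "1 \<le> X" and N: "0 < N" "N < X powr \<alpha>" for X N
  proof -
    define I where "I = {q. squarefree q \<and> N \<le> real q \<and> real q \<le> 2 * N}"
    define Y where "Y = X powr \<alpha>"
    let ?Z = "2 * N * X powr (\<eta> - 1 / d)"
    let ?near = "\<lambda>q. \<Sum>x\<in>lattice_box ?Z. norm (fourier_mod q (\<Psi> q) x)"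
    let ?far = "B * X powr (- \<eta> * real M)"
    have I: "I \<subseteq> {1..nat \<lfloor>2 * N\<rfloor>}"
      using N by (auto simp: I_def le_nat_floor intro!: Suc_leI Nat.gr0I)
    then have "card I \<le> nat \<lfloor>2 * N\<rfloor>"
      using card_mono[OF _ I] by simp
    then have "real (card I) \<le> 2 * N"
      using N by linarith
    then have card_I: "real (card I) \<le> 2 * Y"
      using N by (simp add: Y_def)
    have "(\<Sum>q\<in>I. norm (error_term d X q (\<Psi> q) \<phi>))
        \<le> (\<Sum>q\<in>I. X powr ?D * (A * ?near q + ?far * (2 * Y) ^ ?r))"
    proof (rule sum_mono)
      fix q assume "q \<in> I"
      then have q: "squarefree q" "N \<le> real q" "real q \<le> 2 * N"
        by (auto simp: I_def)
      have "norm (error_term d X q (\<Psi> q) \<phi>) \<le> X powr ?D * (A * ?near q + ?far * real q ^ ?r)"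
        using X N(1) q(2,3) assms(3)[OF q(1)] by (rule error)
      also have "\<dots> \<le> X powr ?D * (A * ?near q + ?far * (2 * Y) ^ ?r)"
        using q N B by (intro mult_left_mono add_left_mono power_mono) (simp_all add: Y_def)
      finally show "norm (error_term d X q (\<Psi> q) \<phi>)
          \<le> X powr ?D * (A * ?near q + ?far * (2 * Y) ^ ?r)" .
    qed
    also have "\<dots> = A * (X powr ?D * (\<Sum>q\<in>I. ?near q)) + real (card I) * (X powr ?D * ?far * (2 * Y) ^ ?r)"
      by (simp add: sum.distrib distrib_left mult_ac flip: sum_distrib_left)
    also have "\<dots> \<le> A * (\<bar>C\<bar> * X powr c) + (2 * Y) * (X powr ?D * ?far * (2 * Y) ^ ?r)"
    proof (intro add_mono mult_left_mono mult_right_mono)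
      have "X powr ?D * (\<Sum>q\<in>I. ?near q) \<le> C * X powr c"
        unfolding I_def using X N by (rule hyp)
      also have "\<dots> \<le> \<bar>C\<bar> * X powr c"
        by (intro mult_right_mono) simp_all
      finally show "X powr ?D * (\<Sum>q\<in>I. ?near q) \<le> \<bar>C\<bar> * X powr c" .
    qed (use A B card_I in \<open>simp_all add: Y_def\<close>)
    also have "(2 * Y) * (X powr ?D * ?far * (2 * Y) ^ ?r)
        = B * 2 ^ (?r + 1) * X powr ((real ?r + 1) * \<alpha> + ?D - \<eta> * real M)"
    proof -
      have "Y ^ (?r + 1) = X powr ((real ?r + 1) * \<alpha>)"
        using X unfolding Y_def by (subst powr_realpow[symmetric]) (simp_all add: powr_powr algebra_simps)
      then have "X powr ((real ?r + 1) * \<alpha> + ?D - \<eta> * real M)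
          = Y ^ (?r + 1) * X powr ?D * X powr (- \<eta> * real M)"
        by (simp add: powr_add powr_diff powr_minus divide_inverse)
      then show ?thesis
        by (simp add: power_mult_distrib mult_ac)
    qed
    also have "\<dots> \<le> B * 2 ^ (?r + 1) * X powr c"
      using M X B by (intro mult_left_mono powr_mono) simp_all
    finally show ?thesis
      by (simp add: I_def T_def algebra_simps)
  qed
  have "(\<Sum>q \<in> {q. squarefree q \<and> real q < X powr \<alpha>}. norm (error_term d X q (\<Psi> q) \<phi>))
      \<le> ((\<alpha> / (\<delta> * ln 2) + 1) * T) * X powr c'" if X: "1 \<le> X" for X
  proof -
    have "(\<Sum>q \<in> {q. squarefree q \<and> real q < X powr \<alpha>}. norm (error_term d X q (\<Psi> q) \<phi>))
        \<le> (log 2 (X powr \<alpha>) + 1) * (T * X powr c)"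
    proof (rule dyadic_sum_bound)
      show "1 \<le> X powr \<alpha>"
        using X assms(5) by (simp add: ge_one_powr_ge_zero)
      show "q > 0" if "squarefree q" for q :: nat
        using that by (intro Nat.gr0I) auto
    qed (use block[OF X] in simp_all)
    also have "\<dots> \<le> ((\<alpha> / (\<delta> * ln 2) + 1) * X powr \<delta>) * (T * X powr c)"
    proof (rule mult_right_mono)
      have "log 2 (X powr \<alpha>) = \<alpha> / ln 2 * ln X"
        using X by (simp add: log_def ln_powr)
      also have "\<dots> \<le> \<alpha> / ln 2 * (X powr \<delta> / \<delta>)"
        using X assms(5) \<delta> by (intro mult_left_mono ln_powr_bound) simp_all
      finally have "log 2 (X powr \<alpha>) \<le> \<alpha> / (\<delta> * ln 2) * X powr \<delta>"
        by (simp add: mult.commute)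
      moreover have "1 \<le> X powr \<delta>"
        using X \<delta> by (simp add: ge_one_powr_ge_zero)
      ultimately show "log 2 (X powr \<alpha>) + 1 \<le> (\<alpha> / (\<delta> * ln 2) + 1) * X powr \<delta>"
        by (simp add: distrib_right)
    qed (use T in simp)
    also have "\<dots> = ((\<alpha> / (\<delta> * ln 2) + 1) * T) * X powr c'"
      by (simp add: \<delta>_def powr_diff)
    finally show ?thesis .
  qed
  with c'(2) show ?thesis
    by blast
qed

end
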